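(* Let $\mathbf{k}$ be a field and let $A=A_0\oplus A_1$ be a special $\mathcal{Z}_2$-graded associative algebra over $\mathbf{k}$. Define $$\langle x,y\rangle := xy_0-y_0x\quad\text{and}\quad [x,y]:=xy-yx$$ for $x\in A$ and $y=y_0+y_1\in A$ with $y_i\in A_i$ ($i=0,1$). Then $(A,+,\langle\,,\,\rangle,[\,,\,])$ is a (right) Hu-Liu Leibniz algebra.
   Context: Associative algebras are over a field $\mathbf{k}$ and are not assumed to have an identity. An associative algebra $A$ is called a special $\mathcal{Z}_2$-graded associative algebra if $A=A_0\oplus A_1$ as vector spaces and $A_0A_0\subseteq A_0$, $A_0A_1+A_1A_0\subseteq A_1$, and $A_1A_1=0$. A right Leibniz algebra over $\mathbf{k}$ is a $\mathbf{k}$-vector space $L$ with a bilinear operation $\langle\,,\,\rangle: L\times L\to L$ (the angle bracket) satisfying $\langle\langle x,y\rangle,z\rangle=\langle x,\langle y,z\rangle\rangle+\langle\langle x,z\rangle,y\rangle$ for all $x,y,z\in L$. A (right) Hu-Liu Leibniz algebra $(L,+,\langle\,,\,\rangle,[\,,\,])$ is a right Leibniz algebra $(L,+,\langle\,,\,\rangle)$ together with an operation $[\,,\,]:L\times L\to L$ (the square bracket) such that $(L,+,[\,,\,])$ is a Lie algebra and, for all $x,y,z\in L$: (1) $\langle x,[y,z]\rangle=\langle x,\langle y,z\rangle\rangle$; (2) $[\langle x,x\rangle,y]=\langle\langle x,x\rangle,y\rangle$; (3) $\langle[x,y],z\rangle+[\langle y,z\rangle,x]+[y,\langle x,z\rangle]=0$;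 (4) $[\langle x,y\rangle,z]+[z,[x,y]]+[z,\langle y,x\rangle]+\langle z,\langle x,y\rangle\rangle=0$. *)

theory Defs
  imports "HOL.Vector_Spaces"
begin

text \<open>
  A \<open>k\<close>-vector space is an instance of the locale \<^locale>\<open>vector_space\<close>: its underlying additive
  group is the whole type \<open>'a\<close>, and \<open>scale\<close> is the action of the field \<open>'k\<close>.
\<close>

definition bilinear_op ::
  "('k::field \<Rightarrow> 'a::ab_group_add \<Rightarrow> 'a) \<Rightarrow> ('a \<Rightarrow> 'a \<Rightarrow> 'a) \<Rightarrow> bool"
  where "bilinear_op scale m \<longleftrightarrow>
    (\<forall>x. Vector_Spaces.linear scale scale (\<lambda>y. m x y)) \<and>
    (\<forall>y. Vector_Spaces.linear scale scale (\<lambda>x. m x y))"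

text \<open>Associative algebras are not assumed to have an identity.\<close>

locale assoc_algebra = vector_space scale
  for scale :: "'k::field \<Rightarrow> 'a::ab_group_add \<Rightarrow> 'a" +
  fixes mult :: "'a \<Rightarrow> 'a \<Rightarrow> 'a"
  assumes mult_bilinear: "bilinear_op scale mult"
    and mult_assoc: "mult (mult x y) z = mult x (mult y z)"

text \<open>
  Since \<open>A0\<close> and \<open>A1\<close> are subspaces, the inclusions between products of subspaces amount to the
  elementwise closure conditions below.
\<close>

locale special_Z2_graded_algebra = assoc_algebra scale mult
  for scale :: "'k::field \<Rightarrow> 'a::ab_group_add \<Rightarrow> 'a"
    and mult :: "'a \<Rightarrow> 'a \<Rightarrow> 'a" +
  fixes A0 A1 :: "'a set"
  assumes subspace_A0: "subspace A0"
    and subspace_A1: "subspace A1"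
    and A0_plus_A1: "{a + b |a b. a \<in> A0 \<and> b \<in> A1} = UNIV"
    and A0_Int_A1: "A0 \<inter> A1 = {0}"
    and mult_A0_A0: "a \<in> A0 \<Longrightarrow> b \<in> A0 \<Longrightarrow> mult a b \<in> A0"
    and mult_A0_A1: "a \<in> A0 \<Longrightarrow> b \<in> A1 \<Longrightarrow> mult a b \<in> A1"
    and mult_A1_A0: "a \<in> A1 \<Longrightarrow> b \<in> A0 \<Longrightarrow> mult a b \<in> A1"
    and mult_A1_A1: "a \<in> A1 \<Longrightarrow> b \<in> A1 \<Longrightarrow> mult a b = 0"

locale lie_algebra = vector_space scale
  for scale :: "'k::field \<Rightarrow> 'a::ab_group_add \<Rightarrow> 'a" +
  fixes sq :: "'a \<Rightarrow> 'a \<Rightarrow> 'a"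
  assumes sq_bilinear: "bilinear_op scale sq"
    and sq_self: "sq x x = 0"
    and jacobi: "sq x (sq y z) + sq y (sq z x) + sq z (sq x y) = 0"

locale right_leibniz_algebra = vector_space scale
  for scale :: "'k::field \<Rightarrow> 'a::ab_group_add \<Rightarrow> 'a" +
  fixes ang :: "'a \<Rightarrow> 'a \<Rightarrow> 'a"
  assumes ang_bilinear: "bilinear_op scale ang"
    and right_leibniz: "ang (ang x y) z = ang x (ang y z) + ang (ang x z) y"

text \<open>Here \<open>ang x y\<close> is the angle bracket and \<open>sq x y\<close> the square bracket.\<close>

locale hu_liu_leibniz_algebra =
  right_leibniz_algebra scale ang + lie_algebra scale sq
  for scale :: "'k::field \<Rightarrow> 'a::ab_group_add \<Rightarrow> 'a"
    and ang :: "'a \<Rightarrow> 'a \<Rightarrow> 'a"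
    and sq :: "'a \<Rightarrow> 'a \<Rightarrow> 'a" +
  assumes hu_liu_1: "ang x (sq y z) = ang x (ang y z)"
    and hu_liu_2: "sq (ang x x) y = ang (ang x x) y"
    and hu_liu_3: "ang (sq x y) z + sq (ang y z) x + sq y (ang x z) = 0"
    and hu_liu_4: "sq (ang x y) z + sq z (sq x y) + sq z (ang y x) + ang z (ang x y) = 0"

definition even_part :: "'a::ab_group_add set \<Rightarrow> 'a set \<Rightarrow> 'a \<Rightarrow> 'a"
  where "even_part A0 A1 y = (THE y0. y0 \<in> A0 \<and> (\<exists>y1\<in>A1. y = y0 + y1))"

definition angle_bracket ::
  "('a::ab_group_add \<Rightarrow> 'a \<Rightarrow> 'a) \<Rightarrow> 'a set \<Rightarrow> 'a set \<Rightarrow> 'a \<Rightarrow> 'a \<Rightarrow> 'a"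
  where "angle_bracket mult A0 A1 x y =
    mult x (even_part A0 A1 y) - mult (even_part A0 A1 y) x"

definition square_bracket :: "('a::ab_group_add \<Rightarrow> 'a \<Rightarrow> 'a) \<Rightarrow> 'a \<Rightarrow> 'a \<Rightarrow> 'a"
  where "square_bracket mult x y = mult x y - mult y x"

lemma (in special_Z2_graded_algebra) even_part_add:
  assumes "y0 \<in> A0" "y1 \<in> A1"
  shows "even_part A0 A1 (y0 + y1) = y0"
  unfolding even_part_def
proof (rule the_equality)
  show "y0 \<in> A0 \<and> (\<exists>y1'\<in>A1. y0 + y1 = y0 + y1')"
    using assms by blast
next
  fix z assume "z \<in> A0 \<and> (\<exists>y1'\<in>A1. y0 + y1 = z + y1')"
  then obtain w where z: "z \<in> A0" and w: "w \<in> A1" and eq: "y0 + y1 = z + w"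
    by blast
  from eq have "z - y0 = y1 - w"
    by (simp add: algebra_simps)
  moreover have "z - y0 \<in> A0" "y1 - w \<in> A1"
    using subspace_diff[OF subspace_A0 z assms(1)] subspace_diff[OF subspace_A1 assms(2) w] by auto
  ultimately have "z - y0 \<in> A0 \<inter> A1"
    by simp
  then show "z = y0"
    using A0_Int_A1 by simp
qed

end

theory Submission
  imports Defs
begin

text \<open>
  Write \<open>p\<close> for the projection of \<open>A\<close> onto \<open>A0\<close> along \<open>A1\<close>. The angle bracket is the commutator
  with the projected second argument, \<open>\<langle>x, y\<rangle> = [x, p y]\<close>. Since \<open>A1\<close> is a two-sided ideal and
  \<open>A0\<close> a subalgebra, \<open>p\<close> is an idempotent algebra endomorphism
  (\<open>linear_even_part\<close>, \<open>even_part_mult\<close>), and hence preserves commutators. So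
  \<open>p [y, z] = [p y, p z] = p [y, p z]\<close>, which gives (1). After the same replacement the right Leibniz
  identity says that commutation with a fixed element is a derivation of the commutator bracket, which
  is a form of the Jacobi identity (\<open>commutator_derivation\<close>). So does (3), up to antisymmetry.

  Identities (2) and (4) rest on \<open>A1 A1 = 0\<close>, in the form \<open>[x - p x, y - p y] = 0\<close>
  (\<open>odd_commutator_eq_0\<close>). For (2), \<open>\<langle>x, x\<rangle>\<close> lies in \<open>A1\<close>, hence commutes with the odd part of \<open>y\<close>.
  For (4), the left-hand side is \<open>[z, w]\<close> with
  \<open>w = [x, y] - [x, p y] - [p x, y] + [p x, p y] = [x - p x, y - p y]\<close>.
\<close>

section \<open>The commutator bracket of an associative algebra\<close>

lemma linear_imp_module_hom: "Vector_Spaces.linear s t f \<Longrightarrow> module_hom s t f"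
  by (rule Vector_Spaces.linear.axioms(3))

lemma
  assumes "bilinear_op s m"
  shows bilinear_op_add_left: "m (x + y) z = m x z + m y z"
    and bilinear_op_add_right: "m z (x + y) = m z x + m z y"
    and bilinear_op_diff_left: "m (x - y) z = m x z - m y z"
    and bilinear_op_diff_right: "m z (x - y) = m z x - m z y"
proof -
  have left: "module_hom s s (\<lambda>x. m x z)" and right: "module_hom s s (m z)"
    using assms by (auto simp: bilinear_op_def intro: linear_imp_module_hom)
  show "m (x + y) z = m x z + m y z" "m (x - y) z = m x z - m y z"
    by (rule module_hom.add[OF left], rule module_hom.diff[OF left])
  show "m z (x + y) = m z x + m z y" "m z (x - y) = m z x - m z y"
    by (rule module_hom.add[OF right], rule module_hom.diff[OF right])
qed

lemma bilinear_op_comp_right: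
  assumes "bilinear_op s m" and "Vector_Spaces.linear s s f"
  shows "bilinear_op s (\<lambda>x y. m x (f y))"
  using assms Vector_Spaces.linear_compose[of s s f s]
  by (auto simp: bilinear_op_def o_def)

context assoc_algebra
begin

lemmas mult_distribs =
  bilinear_op_add_left[OF mult_bilinear] bilinear_op_add_right[OF mult_bilinear]
  bilinear_op_diff_left[OF mult_bilinear] bilinear_op_diff_right[OF mult_bilinear]

lemma bilinear_square_bracket: "bilinear_op scale (square_bracket mult)"
proof -
  interpret vector_space_pair scale scale ..
  show ?thesis
    using mult_bilinear unfolding bilinear_op_def square_bracket_def
    by (auto intro: linear_compose_sub)
qed

lemmas commutator_distribs =
  bilinear_op_add_left[OF bilinear_square_bracket] bilinear_op_add_right[OF bilinear_square_bracket]
  bilinear_op_diff_left[OF bilinear_square_bracket] bilinear_op_diff_right[OF bilinear_square_bracket]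

lemma commutator_antisym: "square_bracket mult x y = - square_bracket mult y x"
  by (simp add: square_bracket_def)

text \<open>
  This derivation form of the Jacobi identity is the one in which the Leibniz-type axioms use it.
\<close>

lemma commutator_derivation:
  "square_bracket mult (square_bracket mult x y) z =
    square_bracket mult x (square_bracket mult y z) + square_bracket mult (square_bracket mult x z) y"
  by (simp add: square_bracket_def mult_distribs mult_assoc)

lemma lie_algebra_square_bracket: "lie_algebra scale (square_bracket mult)"
proof unfold_locales
  show "bilinear_op scale (square_bracket mult)"
    by (rule bilinear_square_bracket)
qed (simp_all add: square_bracket_def mult_distribs mult_assoc)

end

section \<open>The projection onto the even part\<close>

context special_Z2_graded_algebra
begin

abbreviation p :: "'a \<Rightarrow> 'a" where "p \<equiv> even_part A0 A1"

lemma graded_decomposition: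
  obtains y0 y1 where "y0 \<in> A0" "y1 \<in> A1" "y = y0 + y1"
  using A0_plus_A1 by blast

lemma even_part_in_A0: "p y \<in> A0"
  by (rule graded_decomposition[of y]) (simp add: even_part_add)

lemma odd_part_in_A1: "y - p y \<in> A1"
  by (rule graded_decomposition[of y]) (simp add: even_part_add)

lemma even_part_eqI: "a \<in> A0 \<Longrightarrow> y - a \<in> A1 \<Longrightarrow> p y = a"
  using even_part_add[of a "y - a"] by simp

lemma even_part_idem: "p (p y) = p y"
  by (rule even_part_eqI) (simp_all add: even_part_in_A0 subspace_0[OF subspace_A1])

lemma linear_even_part: "Vector_Spaces.linear scale scale p"
proof -
  have add: "p (x + y) = p x + p y" for x y
  proof (rule even_part_eqI)
    show "p x + p y \<in> A0"
      by (intro subspace_add[OF subspace_A0] even_part_in_A0)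
    have "(x - p x) + (y - p y) \<in> A1"
      by (intro subspace_add[OF subspace_A1] odd_part_in_A1)
    then show "x + y - (p x + p y) \<in> A1"
      by (simp add: algebra_simps)
  qed
  have scale: "p (scale c x) = scale c (p x)" for c x
  proof (rule even_part_eqI)
    show "scale c (p x) \<in> A0"
      by (intro subspace_scale[OF subspace_A0] even_part_in_A0)
    have "scale c (x - p x) \<in> A1"
      by (intro subspace_scale[OF subspace_A1] odd_part_in_A1)
    then show "scale c x - scale c (p x) \<in> A1"
      by (simp add: scale_right_diff_distrib)
  qed
  show ?thesis
    by unfold_locales (rule add, rule scale)
qed

lemma even_part_diff: "p (x - y) = p x - p y"
  by (rule module_hom.diff[OF linear_imp_module_hom[OF linear_even_part]])

lemma odd_mult_odd: "mult (x - p x) (y - p y) = 0"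
  by (intro mult_A1_A1 odd_part_in_A1)

text \<open>
  With odd parts \<open>x1\<close> and \<open>y1\<close>, the difference \<open>x y - p x p y\<close> is \<open>x1 (p y) + (p x) y1 + x1 y1\<close>, where
  the last term vanishes and the first two lie in \<open>A1\<close>.
\<close>

lemma even_part_mult: "p (mult x y) = mult (p x) (p y)"
proof (rule even_part_eqI)
  show "mult (p x) (p y) \<in> A0"
    by (intro mult_A0_A0 even_part_in_A0)
  have "mult (x - p x) (p y) + mult (p x) (y - p y) \<in> A1"
    by (intro subspace_add[OF subspace_A1] mult_A1_A0 mult_A0_A1 even_part_in_A0 odd_part_in_A1)
  also have "mult (x - p x) (p y) + mult (p x) (y - p y) =
      mult x y - mult (p x) (p y) - mult (x - p x) (y - p y)"
    by (simp add: mult_distribs)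
  finally show "mult x y - mult (p x) (p y) \<in> A1"
    by (simp add: odd_mult_odd)
qed

lemma even_part_commutator:
  "p (square_bracket mult x y) = square_bracket mult (p x) (p y)"
  by (simp add: square_bracket_def even_part_diff even_part_mult)

lemma odd_commutator_eq_0: "square_bracket mult (x - p x) (y - p y) = 0"
  by (simp add: square_bracket_def odd_mult_odd)

section \<open>The Hu-Liu Leibniz identities\<close>

lemma angle_bracket_eq: "angle_bracket mult A0 A1 = (\<lambda>x y. square_bracket mult x (p y))"
  by (simp add: angle_bracket_def square_bracket_def fun_eq_iff)

lemma hu_liu_leibniz_algebra_brackets:
  "hu_liu_leibniz_algebra scale (angle_bracket mult A0 A1) (square_bracket mult)"
proof -
  let ?c = "square_bracket mult"
  interpret lie_algebra scale ?c
    by (rule lie_algebra_square_bracket)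
  have bil: "bilinear_op scale (\<lambda>x y. ?c x (p y))"
    by (rule bilinear_op_comp_right[OF bilinear_square_bracket linear_even_part])
  have leibniz: "?c (?c x (p y)) (p z) = ?c x (p (?c y (p z))) + ?c (?c x (p z)) (p y)" for x y z
    by (simp add: even_part_commutator even_part_idem commutator_derivation[of x "p y"])
  have hl1: "?c x (p (?c y z)) = ?c x (p (?c y (p z)))" for x y z
    by (simp add: even_part_commutator even_part_idem)
  have hl2: "?c (?c x (p x)) y = ?c (?c x (p x)) (p y)" for x y
  proof -
    \<comment> \<open>The square \<open>\<langle>x, x\<rangle>\<close> is odd: its even part is the commutator of \<open>p x\<close> with itself.\<close>
    have "p (?c x (p x)) = 0"
      by (simp add: even_part_commutator even_part_idem sq_self)
    then show ?thesis
      using odd_commutator_eq_0[of "?c x (p x)" y] by (simp add: commutator_distribs)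
  qed
  have hl3: "?c (?c x y) (p z) + ?c (?c y (p z)) x + ?c y (?c x (p z)) = 0" for x y z
    by (simp add: commutator_derivation[of x y] commutator_antisym[of "?c y (p z)" x]
        commutator_antisym[of y "?c x (p z)"])
  have hl4: "?c (?c x (p y)) z + ?c z (?c x y) + ?c z (?c y (p x)) + ?c z (p (?c x (p y))) = 0"
    for x y z
  proof -
    have "?c (?c x (p y)) z + ?c z (?c x y) + ?c z (?c y (p x)) + ?c z (p (?c x (p y))) =
        ?c z (?c x y - ?c x (p y) + ?c y (p x) + ?c (p x) (p y))"
      by (simp add: commutator_antisym[of "?c x (p y)" z] even_part_commutator even_part_idem
          commutator_distribs)
    also have "?c x y - ?c x (p y) + ?c y (p x) + ?c (p x) (p y) = ?c (x - p x) (y - p y)"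
      by (simp add: commutator_antisym[of y "p x"] commutator_distribs)
    \<comment> \<open>Distributivity over \<open>0 - 0\<close> yields \<open>[z, 0] = 0\<close>.\<close>
    also have "?c z (?c (x - p x) (y - p y)) = 0"
      using commutator_distribs(4)[of z 0 0] by (simp add: odd_commutator_eq_0)
    finally show ?thesis .
  qed
  show ?thesis
    unfolding angle_bracket_eq
    by unfold_locales (rule bil leibniz hl1 hl2 hl3 hl4)+
qed

end

theorem proposition2p1:
  fixes scale :: "'k::field \<Rightarrow> 'a::ab_group_add \<Rightarrow> 'a"
    and mult :: "'a \<Rightarrow> 'a \<Rightarrow> 'a"
    and A0 A1 :: "'a set"
  assumes "special_Z2_graded_algebra scale mult A0 A1"
  shows "hu_liu_leibniz_algebra scale (angle_bracket mult A0 A1) (square_bracket mult)"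
  using assms by (rule special_Z2_graded_algebra.hu_liu_leibniz_algebra_brackets)

end
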